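(* For every integer $n\geq 1$ there exists a finitely generated group $G_n$ which is $\omega\cdot n$-residually finite but not $\omega\cdot(n-1)$-residually finite.
   Context: Let $\alpha$ be an ordinal. A group $G$ is called $\alpha$-residually finite if there exists a descending $\alpha$-indexed chain $\{\mathscr{C}_i(G)\}_{i\leq\alpha}$ of subgroups of $G$ (not required to be normal) such that: (i) $\mathscr{C}_0(G)=G$ and $\mathscr{C}_\alpha(G)=\{1\}$; (ii) $[\mathscr{C}_i(G):\mathscr{C}_{i+1}(G)]<\aleph_0$ for all $i<\alpha$; (iii) $\mathscr{C}_\lambda(G)=\bigcap_{i<\lambda}\mathscr{C}_i(G)$ for every limit ordinal $\lambda\leq\alpha$. Limit ordinals are non-zero. Here $\omega$ is the order type of the natural numbers, and $\omega\cdot n$ is the usual ordinal product, i.e. the order type of $n$ copies of $\omega$ placed one after another (so $\omega\cdot 0=0$). *)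

theory Defs
  imports Main "HOL-Algebra.Generated_Groups"
begin

text \<open>
  An ordinal is presented as a well-order relation \<open>r\<close> (on its field), taken up to isomorphism.
  The indices \<open>i \<le> \<alpha>\<close> are presented, in von Neumann style, as the initial segments of \<open>r\<close>
  (\<open>ofilter r\<close>), which are well-ordered by inclusion with order type \<open>\<alpha> + 1\<close>:
  the ordinal \<open>0\<close> is the empty segment and \<open>\<alpha>\<close> itself is \<open>Field r\<close>;
  the indices \<open>i < \<alpha>\<close> are the segments \<open>underS r a\<close> with \<open>a \<in> Field r\<close>, and the successor of
  \<open>underS r a\<close> is \<open>under r a\<close>.
\<close>

text \<open>A limit ordinal is one that is neither zero nor a successor.\<close>

definition limit_segment :: "'o rel \<Rightarrow> 'o set \<Rightarrow> bool"
  where "limit_segment r L \<longleftrightarrow>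
    ofilter r L \<and> L \<noteq> {} \<and> (\<forall>a\<in>Field r. L \<noteq> under r a)"

text \<open>The index \<open>[H : K]\<close> is taken inside the subgroup \<open>H\<close> of \<open>G\<close>.\<close>

definition finite_index_in :: "('g, 'm) monoid_scheme \<Rightarrow> 'g set \<Rightarrow> 'g set \<Rightarrow> bool"
  where "finite_index_in G H K \<longleftrightarrow> finite (rcosets\<^bsub>G\<lparr>carrier := H\<rparr>\<^esub> K)"

definition residually_finite_chain ::
    "'o rel \<Rightarrow> ('g, 'm) monoid_scheme \<Rightarrow> ('o set \<Rightarrow> 'g set) \<Rightarrow> bool"
  where "residually_finite_chain r G C \<longleftrightarrow>
    (\<forall>I. ofilter r I \<longrightarrow> subgroup (C I) G) \<and>
    (\<forall>I J. ofilter r I \<longrightarrow> ofilter r J \<longrightarrow> I \<subseteq> J \<longrightarrow> C J \<subseteq> C I) \<and>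
    C {} = carrier G \<and>
    C (Field r) = {\<one>\<^bsub>G\<^esub>} \<and>
    (\<forall>a\<in>Field r. finite_index_in G (C (underS r a)) (C (under r a))) \<and>
    (\<forall>L. limit_segment r L \<longrightarrow> C L = (\<Inter>I\<in>{I. ofilter r I \<and> I \<subset> L}. C I))"

text \<open>Meaningful when \<open>r\<close> is a well-order and \<open>G\<close> is a group.\<close>

definition residually_finite :: "'o rel \<Rightarrow> ('g, 'm) monoid_scheme \<Rightarrow> bool"
  where "residually_finite r G \<longleftrightarrow> (\<exists>C. residually_finite_chain r G C)"

definition finitely_generated :: "('g, 'm) monoid_scheme \<Rightarrow> bool"
  where "finitely_generated G \<longleftrightarrow>
    (\<exists>S. finite S \<and> S \<subseteq> carrier G \<and> generate G S = carrier G)"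

text \<open>
  The ordinal product \<open>r \<cdot> s\<close>: copies of \<open>r\<close> placed one after another along \<open>s\<close>, so the second
  component is the more significant one.
\<close>

definition ord_prod :: "'a rel \<Rightarrow> 'b rel \<Rightarrow> ('a \<times> 'b) rel"
  where "ord_prod r s = {((x, y), (x', y')).
    x \<in> Field r \<and> x' \<in> Field r \<and> y \<in> Field s \<and> y' \<in> Field s \<and>
    ((y, y') \<in> s - Id \<or> y = y' \<and> (x, x') \<in> r)}"

definition omega_times :: "nat \<Rightarrow> (nat \<times> nat) rel"
  where "omega_times n = ord_prod natLeq (natLeq_on n)"

lemma omega_times_iff:
  "((x, y), (x', y')) \<in> omega_times n \<longleftrightarrow>
     y < n \<and> y' < n \<and> (y < y' \<or> y = y' \<and> x \<le> x')"
  unfolding omega_times_def ord_prod_def Field_natLeq Field_natLeq_on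
  by (auto simp: natLeq_def)

lemma Field_omega_times: "Field (omega_times n) = UNIV \<times> {..<n}"
proof
  show "Field (omega_times n) \<subseteq> UNIV \<times> {..<n}"
    by (auto simp: Field_def omega_times_iff)
  show "UNIV \<times> {..<n} \<subseteq> Field (omega_times n)"
  proof
    fix p :: "nat \<times> nat" assume "p \<in> UNIV \<times> {..<n}"
    then have "(p, p) \<in> omega_times n"
      by (cases p) (auto simp: omega_times_iff)
    then show "p \<in> Field (omega_times n)"
      by (rule FieldI1)
  qed
qed

lemma Well_order_omega_times: "Well_order (omega_times n)"
proof -
  have "omega_times n - Id \<subseteq> inv_image (less_than <*lex*> less_than) (\<lambda>(x, y). (y, x))"
    by (auto simp: omega_times_iff)
  then have "wf (omega_times n - Id)"
    by (rule wf_subset[rotated]) (intro wf_inv_image wf_lex_prod wf_less_than)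
  moreover have "refl_on (Field (omega_times n)) (omega_times n)"
    by (auto simp: refl_on_def Field_omega_times omega_times_iff)
  moreover have "omega_times n \<subseteq> Field (omega_times n) \<times> Field (omega_times n)"
    by (auto simp: Field_omega_times omega_times_iff)
  moreover have "trans (omega_times n)"
    by (rule transI) (auto simp: omega_times_iff)
  moreover have "antisym (omega_times n)"
    by (rule antisymI) (auto simp: omega_times_iff)
  moreover have "total_on (Field (omega_times n)) (omega_times n)"
    by (auto simp: total_on_def Field_omega_times omega_times_iff)
  ultimately show ?thesis
    by (simp add: order_on_defs)
qed

end

theory Submission
  imports Defs "HOL-Library.Numeral_Type" "HOL-Library.Countable_Set"
begin

text \<open>
  The group is the \<open>n\<close>-fold iterated permutational wreath power of the group \<open>P\<close> generated by the
  elementary \<open>3 \<times> 3\<close> integer matrices, which acts on \<open>\<int>\<^sup>3\<close>: a group of automorphisms of the tree of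
  words over \<open>\<int>\<^sup>3\<close>. The stabilizers of the levels of the tree form a chain of length \<open>n\<close>; a
  congruence modulo \<open>m\<close> on the image of one vertex of level \<open>k + 1\<close> defines a subgroup of finite
  index in the stabilizer of level \<open>k\<close>, and countably many of these intersect in the stabilizer of
  level \<open>k + 1\<close>. Hence \<open>\<omega> \<cdot> n\<close> steps reach the trivial group.

  Conversely, let \<open>T\<^sub>k\<close> be the copy of the \<open>(n - k)\<close>-fold wreath power that acts below a fixed vertex
  of level \<open>k\<close>. A subgroup of finite index in \<open>T\<^sub>k\<close> has a core containing some \<open>c\<close> that moves the
  chosen vertex of level \<open>k + 1\<close>, so \<open>c T\<^sub>k\<^sub>+\<^sub>1 c\<^sup>-\<^sup>1\<close> commutes with \<open>T\<^sub>k\<^sub>+\<^sub>1\<close> and the core contains the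
  commutators of \<open>T\<^sub>k\<^sub>+\<^sub>1\<close>. Since \<open>e\<^sub>i\<^sub>j = [e\<^sub>i\<^sub>p, e\<^sub>p\<^sub>j]\<close>, these generate \<open>T\<^sub>k\<^sub>+\<^sub>1\<close>. So \<open>\<omega>\<close> further steps
  of a chain never cut below \<open>T\<^sub>k\<^sub>+\<^sub>1\<close>, and \<open>\<omega> \<cdot> (n - 1)\<close> steps leave \<open>T\<^bsub>n-1\<^esub> \<noteq> 1\<close>.
\<close>

section \<open>Chains of subgroups of finite index\<close>

lemma rcosets_restrict_carrier:
  "rcosets\<^bsub>G\<lparr>carrier := H\<rparr>\<^esub> K = (\<lambda>h. K #>\<^bsub>G\<^esub> h) ` H"
  by (auto simp: RCOSETS_def r_coset_def)

text \<open>Elements of \<open>H\<close> with equal \<open>f\<close>-values lie in one right coset,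
  so \<open>K #> h\<close> depends only on \<open>f h\<close>.\<close>

lemma (in group) finite_index_inI:
  assumes "subgroup K G" "H \<subseteq> carrier G" "finite (f ` H)"
    and "\<And>h h'. h \<in> H \<Longrightarrow> h' \<in> H \<Longrightarrow> f h = f h' \<Longrightarrow> h \<otimes> inv h' \<in> K"
  shows "finite_index_in G H K"
proof -
  have "K #> h = K #> (SOME h'. h' \<in> H \<and> f h' = f h)" if "h \<in> H" for h
  proof -
    let ?h = "SOME h'. h' \<in> H \<and> f h' = f h"
    have h': "?h \<in> H \<and> f ?h = f h"
      by (rule someI[where x = h]) (use that in simp)
    then have "h \<otimes> inv ?h \<in> K" "?h \<in> carrier G" "h \<in> carrier G"
      using that assms by auto
    then have "K #> h = K #> (h \<otimes> inv ?h \<otimes> ?h)"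
      by (simp add: m_assoc)
    also have "\<dots> = (K #> (h \<otimes> inv ?h)) #> ?h"
      using assms(1) \<open>?h \<in> carrier G\<close> \<open>h \<in> carrier G\<close>
      by (simp add: coset_mult_assoc subgroup.subset)
    also have "K #> (h \<otimes> inv ?h) = K"
      using assms(1) \<open>h \<otimes> inv ?h \<in> K\<close> by (simp add: coset_join2 subgroup.mem_carrier)
    finally show ?thesis .
  qed
  then have "(\<lambda>h. K #> h) ` H \<subseteq> (\<lambda>y. K #> (SOME h'. h' \<in> H \<and> f h' = y)) ` f ` H"
    by blast
  then show ?thesis
    unfolding finite_index_in_def rcosets_restrict_carrier
    using assms(3) finite_surj by blast
qed

text \<open>With \<open>r\<close> a chosen representative of \<open>L #> a\<close> and
  \<open>a = l \<otimes> r\<close>, the coset \<open>K #> a\<close> is determined by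
  \<open>L #> a\<close> and \<open>K #> l\<close>. It is applied to an \<open>A\<close> that may
  stick out of \<open>L\<close>.\<close>

lemma (in group) finite_cosets_trans:
  assumes "K \<subseteq> carrier G" "L \<subseteq> carrier G" "A \<subseteq> carrier G" "\<one> \<in> L"
    and "finite_index_in G L K" "finite ((\<lambda>a. L #> a) ` A)"
  shows "finite ((\<lambda>a. K #> a) ` A)"
proof -
  let ?Q = "(\<lambda>x. K #> x) ` L"
  let ?r = "\<lambda>Y. SOME a. a \<in> A \<and> L #> a = Y"
  have "K #> a \<in> (\<lambda>(X, Y). X #> ?r Y) ` (?Q \<times> (\<lambda>a. L #> a) ` A)" if a: "a \<in> A" for a
  proof -
    have r: "?r (L #> a) \<in> A \<and> L #> ?r (L #> a) = L #> a"
      by (rule someI[where x = a]) (use a in simp)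
    have "a \<in> L #> a"
      using a assms(3,4) by (force simp: r_coset_def)
    then obtain l where l: "l \<in> L" "a = l \<otimes> ?r (L #> a)"
      using r by (auto simp: r_coset_def)
    then have "K #> a = (K #> l) #> ?r (L #> a)"
      using r assms(1-3) by (metis coset_mult_assoc subset_iff)
    then show ?thesis
      using l(1) a by force
  qed
  then have "(\<lambda>a. K #> a) ` A \<subseteq> (\<lambda>(X, Y). X #> ?r Y) ` (?Q \<times> (\<lambda>a. L #> a) ` A)"
    by blast
  moreover have "finite (?Q \<times> (\<lambda>a. L #> a) ` A)"
    using assms(5,6) by (simp add: finite_index_in_def rcosets_restrict_carrier)
  ultimately show ?thesis
    using finite_surj by blast
qed

lemma (in group) subgroup_carrier_INT:
  assumes "\<And>a. a \<in> I \<Longrightarrow> subgroup (F a) G"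
  shows "subgroup (carrier G \<inter> (\<Inter>a\<in>I. F a)) G"
proof -
  have "carrier G \<inter> (\<Inter>a\<in>I. F a) = \<Inter>(insert (carrier G) (F ` I))"
    by auto
  also have "subgroup \<dots> G"
    using assms subgroup_self by (intro subgroups_Inter) auto
  finally show ?thesis .
qed

text \<open>Intersecting the \<open>F a\<close> over a segment makes the chain descending and
  continuous at limits by construction.\<close>

lemma (in group) residually_finiteI:
  assumes "Well_order r"
    and sub: "\<And>a. a \<in> Field r \<Longrightarrow> subgroup (F a) G"
    and one: "carrier G \<inter> (\<Inter>a\<in>Field r. F a) = {\<one>}"
    and fin: "\<And>a. a \<in> Field r \<Longrightarrow>
      finite_index_in G (carrier G \<inter> (\<Inter>b\<in>underS r a. F b)) (carrier G \<inter> (\<Inter>b\<in>under r a. F b))"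
  shows "residually_finite r G"
proof -
  define C where "C I = carrier G \<inter> (\<Inter>a\<in>I. F a)" for I
  have wo: "wo_rel r"
    using assms(1) by (simp add: wo_rel_def)
  have "subgroup (C I) G" if "ofilter r I" for I
    unfolding C_def using that by (intro subgroup_carrier_INT sub) (auto simp: ofilter_def)
  moreover have "C L = (\<Inter>I\<in>{I. ofilter r I \<and> I \<subset> L}. C I)" if L: "limit_segment r L" for L
  proof
    show "C L \<subseteq> (\<Inter>I\<in>{I. ofilter r I \<and> I \<subset> L}. C I)"
      by (auto simp: C_def)
    have "{} \<in> {I. ofilter r I \<and> I \<subset> L}"
      using L by (auto simp: limit_segment_def ofilter_def)
    then have "(\<Inter>I\<in>{I. ofilter r I \<and> I \<subset> L}. C I) \<subseteq> carrier G"
      by (auto simp: C_def)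
    moreover have "(\<Inter>I\<in>{I. ofilter r I \<and> I \<subset> L}. C I) \<subseteq> F a" if a: "a \<in> L" for a
    proof -
      \<comment> \<open>A limit segment is never \<open>under r a\<close>, so this segment is a
        proper one, and it contains \<open>a\<close>.\<close>
      have "under r a \<in> {I. ofilter r I \<and> I \<subset> L}"
        using a L wo_rel.under_ofilter[OF wo, of a]
        by (auto simp: limit_segment_def ofilter_def psubset_eq)
      moreover have "a \<in> under r a"
        using a L Refl_under_in[OF wo_rel.REFL[OF wo]] by (auto simp: limit_segment_def ofilter_def)
      ultimately show ?thesis
        unfolding C_def by blast
    qed
    ultimately show "(\<Inter>I\<in>{I. ofilter r I \<and> I \<subset> L}. C I) \<subseteq> C L"
      unfolding C_def[of L] by blast
  qed
  ultimately have "residually_finite_chain r G C"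
    using one fin unfolding residually_finite_chain_def
    by (auto simp: C_def)
  then show ?thesis
    by (auto simp: residually_finite_def)
qed

text \<open>\<open>D k\<close> lies in the term reached after \<open>k\<close> blocks of
  \<open>\<omega>\<close>. In the next block \<open>step\<close> puts \<open>D (Suc k)\<close> into
  every term, hence into the limit.\<close>

lemma (in group) not_residually_finite_omega_times:
  assumes "D 0 \<subseteq> carrier G" "\<And>k. D (Suc k) \<subseteq> D k"
    and step: "\<And>k K. subgroup K G \<Longrightarrow> finite ((\<lambda>d. K #> d) ` D k) \<Longrightarrow> D (Suc k) \<subseteq> K"
    and "residually_finite (omega_times n) G"
  shows "D n \<subseteq> {\<one>}"
proof -
  let ?r = "omega_times n"
  have wo: "wo_rel ?r"
    using Well_order_omega_times by (simp add: wo_rel_def)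
  obtain C where C: "residually_finite_chain ?r G C"
    using assms(4) by (auto simp: residually_finite_def)
  have sub: "subgroup (C I) G" if "ofilter ?r I" for I
    using C that by (simp add: residually_finite_chain_def)
  have mono: "C J \<subseteq> C I" if "ofilter ?r I" "ofilter ?r J" "I \<subseteq> J" for I J
    using C that by (simp add: residually_finite_chain_def)
  define seg :: "nat \<Rightarrow> (nat \<times> nat) set" where "seg k = UNIV \<times> {..<k}" for k
  have uS: "underS ?r (t, k) = seg k \<union> {..<t} \<times> {k}" if "k < n" for t k
    using that by (auto simp: underS_def omega_times_iff seg_def)
  have u: "under ?r (t, k) = underS ?r (Suc t, k)" if "k < n" for t k
    using that unfolding uS[OF that] by (auto simp: under_def omega_times_iff seg_def)
  have D: "D k \<subseteq> carrier G" for k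
    using assms(1,2) by (induction k) blast+
  have "D k \<subseteq> C (seg k)" if "k \<le> n" for k
    using that
  proof (induction k)
    case 0
    then show ?case
      using C assms(1) by (simp add: seg_def residually_finite_chain_def)
  next
    case (Suc k)
    then have k: "k < n" and IH: "D k \<subseteq> C (seg k)" by auto
    have "finite ((\<lambda>d. C (underS ?r (t, k)) #> d) ` D k)" for t
    proof (induction t)
      case 0
      have "ofilter ?r (seg k)"
        using wo_rel.underS_ofilter[OF wo, of "(0, k)"] k by (simp add: uS)
      then have "(\<lambda>d. C (underS ?r (0, k)) #> d) ` D k \<subseteq> {C (seg k)}"
        using IH k D sub by (auto simp: uS coset_join2 subset_iff)
      then show ?case
        using finite_subset by blast
    next
      case (Suc t)
      have "finite_index_in G (C (underS ?r (t, k))) (C (underS ?r (Suc t, k)))"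
        using C k u[OF k] unfolding residually_finite_chain_def
        by (metis Field_omega_times SigmaI UNIV_I lessThan_iff)
      moreover have "C (underS ?r (t', k)) \<subseteq> carrier G" "\<one> \<in> C (underS ?r (t', k))" for t'
        using sub[OF wo_rel.underS_ofilter[OF wo, of "(t', k)"]]
        by (simp_all add: subgroup.subset subgroup.one_closed)
      ultimately show ?case
        by (intro finite_cosets_trans[OF _ _ D _ _ Suc])
    qed
    then have below: "D (Suc k) \<subseteq> C (underS ?r (t, k))" for t
      using step[OF sub[OF wo_rel.underS_ofilter[OF wo]]] by blast
    have of: "ofilter ?r (seg (Suc k))"
      using Suc.prems by (auto simp: ofilter_def seg_def Field_omega_times under_def omega_times_iff)
    have "limit_segment ?r (seg (Suc k))"
      unfolding limit_segment_def
    proof (intro conjI ballI of)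
      show "seg (Suc k) \<noteq> {}" by (auto simp: seg_def)
      fix a assume "a \<in> Field ?r"
      moreover obtain x y where "a = (x, y)" by force
      \<comment> \<open>\<open>under ?r a\<close> has the last element \<open>(x, y)\<close>,
        whereas \<open>seg (Suc k)\<close> contains \<open>(Suc x, y)\<close> along with
        \<open>(x, y)\<close>.\<close>
      ultimately have "(0, Suc y) \<notin> under ?r a" "(Suc x, y) \<notin> under ?r a" "a \<in> under ?r a"
        by (auto simp: under_def omega_times_iff Field_omega_times)
      then show "seg (Suc k) \<noteq> under ?r a"
        using \<open>a = (x, y)\<close> by (auto simp: seg_def)
    qed
    then have "C (seg (Suc k)) = (\<Inter>I\<in>{I. ofilter ?r I \<and> I \<subset> seg (Suc k)}. C I)"
      using C by (simp add: residually_finite_chain_def)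
    moreover have "D (Suc k) \<subseteq> C I" if I: "ofilter ?r I" "I \<subset> seg (Suc k)" for I
    proof -
      \<comment> \<open>The segments \<open>underS ?r (t, k)\<close> are cofinal: missing
        \<open>(t, y)\<close> with \<open>y \<le> k\<close> entails missing
        \<open>(t, k)\<close>.\<close>
      obtain t y where ty: "(t, y) \<in> seg (Suc k)" "(t, y) \<notin> I"
        using I(2) by auto
      have down: "p \<in> I" if "q \<in> I" "(p, q) \<in> ?r" for p q
        using I(1) that unfolding ofilter_def under_def by blast
      have "((t, y), (t, k)) \<in> ?r"
        using ty(1) k by (auto simp: omega_times_iff seg_def)
      then have "(t, k) \<notin> I"
        using ty(2) down by blast
      have "I \<subseteq> underS ?r (t, k)"
      proof clarify
        fix x z assume xz: "(x, z) \<in> I"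
        then have "z \<le> k"
          using I(2) by (auto simp: seg_def)
        moreover have "\<not> (z = k \<and> t \<le> x)"
          using down[OF xz, of "(t, k)"] \<open>(t, k) \<notin> I\<close> k by (auto simp: omega_times_iff)
        ultimately show "(x, z) \<in> underS ?r (t, k)"
          by (auto simp: uS[OF k] seg_def)
      qed
      then show ?thesis
        using below mono[OF I(1) wo_rel.underS_ofilter[OF wo]] by blast
    qed
    ultimately show ?case by blast
  qed
  then have "D n \<subseteq> C (Field ?r)"
    by (simp add: seg_def Field_omega_times)
  then show ?thesis
    using C by (simp add: residually_finite_chain_def)
qed

section \<open>Commutators in subgroups of finite index\<close>

lemma (in group) inv_cancel:
  assumes "x \<in> carrier G" "y \<in> carrier G"
  shows "x \<otimes> (inv x \<otimes> y) = y" "inv x \<otimes> (x \<otimes> y) = y"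
  using assms by (simp_all flip: m_assoc)

text \<open>
  Some power \<open>c\<close> of \<open>a\<close> acts trivially on the finitely many cosets, so all \<open>T\<close>-conjugates of \<open>c\<close> lie
  in \<open>K\<close>. As \<open>c h c\<^sup>-\<^sup>1\<close> commutes with \<open>g\<close>, the commutator \<open>[h, g]\<close> equals \<open>[[h, c], g]\<close>, which is
  a product of such conjugates.
\<close>

lemma (in group) commutator_in_finite_index:
  assumes "subgroup T G" "subgroup K G" "finite ((\<lambda>t. K #> t) ` T)"
    and "a \<in> T" "g \<in> T" "h \<in> T"
    and comm: "\<And>m::nat. m > 0 \<Longrightarrow>
      (a [^] m \<otimes> h \<otimes> inv (a [^] m)) \<otimes> g = g \<otimes> (a [^] m \<otimes> h \<otimes> inv (a [^] m))"
  shows "h \<otimes> g \<otimes> inv h \<otimes> inv g \<in> K"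
proof -
  interpret T: subgroup T G by fact
  interpret K: subgroup K G by fact
  let ?Q = "(\<lambda>t. K #> t) ` T"
  have pow: "a [^] m \<in> T" for m :: nat
    using assms(4) by (induction m) auto
  \<comment> \<open>\<open>\<phi> m\<close> is right translation by \<open>a [^] m\<close> on a
    finite set of cosets, so two powers translate alike; their quotient is \<open>c\<close>.\<close>
  define \<phi> where "\<phi> m = (\<lambda>X\<in>?Q. X #> a [^] m)" for m :: nat
  have "(K #> t) #> a [^] m = K #> (t \<otimes> a [^] m)" if "t \<in> T" for t and m :: nat
    using that pow K.subset by (intro coset_mult_assoc) auto
  then have "range \<phi> \<subseteq> ?Q \<rightarrow>\<^sub>E ?Q"
    using pow by (auto simp: \<phi>_def)
  then have "finite (range \<phi>)"
    using assms(3) by (meson finite_PiE finite_subset)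
  then have "\<not> inj \<phi>"
    using finite_imageD infinite_UNIV_nat by blast
  then obtain p q where pq: "p < q" "\<phi> p = \<phi> q"
    by (metis injI linorder_neqE_nat)
  define c where "c = a [^] (q - p)"
  have cT: "c \<in> T"
    unfolding c_def by (rule pow)
  have core: "t \<otimes> c \<otimes> inv t \<in> K" if t: "t \<in> T" for t
  proof -
    have "(K #> t) #> a [^] p = (K #> t) #> a [^] q"
      using fun_cong[OF pq(2), of "K #> t"] t by (auto simp: \<phi>_def)
    then have "K #> (t \<otimes> a [^] p) = K #> (t \<otimes> a [^] q)"
      using t pow K.subset by (simp add: coset_mult_assoc)
    moreover have "a [^] q = c \<otimes> a [^] p"
      using pq(1) assms(4) by (simp add: c_def nat_pow_mult)
    ultimately have "K #> (t \<otimes> a [^] p) = K #> ((t \<otimes> c \<otimes> inv t) \<otimes> (t \<otimes> a [^] p))"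
      using t pow cT by (simp add: m_assoc inv_cancel)
    then have "(t \<otimes> c \<otimes> inv t) \<otimes> (t \<otimes> a [^] p) \<in> K #> (t \<otimes> a [^] p)"
      using t pow cT by (metis T.mem_carrier T.m_closed T.m_inv_closed assms(2) rcos_self)
    then obtain x where "x \<in> K" "(t \<otimes> c \<otimes> inv t) \<otimes> (t \<otimes> a [^] p) = x \<otimes> (t \<otimes> a [^] p)"
      by (auto simp: r_coset_def)
    then show ?thesis
      using t pow cT by (metis T.mem_carrier T.m_closed T.m_inv_closed K.mem_carrier right_cancel)
  qed
  have core': "t \<otimes> inv c \<otimes> inv t \<in> K" if t: "t \<in> T" for t
    using K.m_inv_closed[OF core[OF t]] t cT by (simp add: inv_mult_group m_assoc)
  have [simp]: "c \<in> carrier G" "g \<in> carrier G" "h \<in> carrier G"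
    using cT assms(5,6) by auto
  \<comment> \<open>This is \<open>[[h, c], g]\<close>, regrouped so that \<open>comm\<close>
    carries \<open>c \<otimes> h \<otimes> inv c\<close> past \<open>g\<close> to cancel its
    inverse.\<close>
  have "(h \<otimes> c \<otimes> inv h) \<otimes> inv c \<otimes> (g \<otimes> c \<otimes> inv g) \<otimes> ((g \<otimes> h) \<otimes> inv c \<otimes> inv (g \<otimes> h))
      = h \<otimes> inv (c \<otimes> h \<otimes> inv c) \<otimes> (g \<otimes> (c \<otimes> h \<otimes> inv c)) \<otimes> inv h \<otimes> inv g"
    by (simp add: m_assoc inv_mult_group inv_cancel)
  also have "\<dots> = h \<otimes> g \<otimes> inv h \<otimes> inv g"
    unfolding comm[OF zero_less_diff[THEN iffD2, OF pq(1)], folded c_def, symmetric]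
    by (simp add: m_assoc inv_mult_group inv_cancel)
  finally have "h \<otimes> g \<otimes> inv h \<otimes> inv g = (h \<otimes> c \<otimes> inv h) \<otimes> inv c \<otimes> (g \<otimes> c \<otimes> inv g) \<otimes> ((g \<otimes> h) \<otimes> inv c \<otimes> inv (g \<otimes> h))"
    by simp
  also have "\<dots> \<in> K"
    using core core' core'[of \<one>] assms(5,6) by auto
  finally show ?thesis .
qed

section \<open>Transport to the natural numbers\<close>

lemma (in group_hom) r_coset_image:
  assumes "K \<subseteq> carrier G" "a \<in> carrier G"
  shows "h ` (K #> a) = h ` K #>\<^bsub>H\<^esub> h a"
  using assms by (force simp: r_coset_def)

text \<open>The chain is mapped termwise; injectivity makes images commute with the intersections at
  limits.\<close>

lemma residually_finite_iso:
  assumes "group G" "group H" "h \<in> iso G H" "residually_finite r G" "Well_order r"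
  shows "residually_finite r H"
proof -
  interpret group_hom G H h
    using assms by (simp add: group_hom_def group_hom_axioms_def iso_def)
  have wo: "wo_rel r"
    using assms(5) by (simp add: wo_rel_def)
  obtain C where C: "residually_finite_chain r G C"
    using assms(4) by (auto simp: residually_finite_def)
  have inj: "inj_on h (carrier G)" and img: "h ` carrier G = carrier H"
    using assms(3) by (auto simp: iso_def bij_betw_def)
  have sub: "subgroup (C I) G" if "ofilter r I" for I
    using C that by (simp add: residually_finite_chain_def)
  have "finite_index_in H (h ` C (underS r a)) (h ` C (under r a))" if "a \<in> Field r" for a
  proof -
    have "finite_index_in G (C (underS r a)) (C (under r a))"
      using C that by (simp add: residually_finite_chain_def)
    then have "finite ((`) h ` (\<lambda>x. C (under r a) #>\<^bsub>G\<^esub> x) ` C (underS r a))"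
      by (simp add: finite_index_in_def rcosets_restrict_carrier)
    moreover have "(`) h ` (\<lambda>x. C (under r a) #>\<^bsub>G\<^esub> x) ` C (underS r a)
        = (\<lambda>x. h ` C (under r a) #>\<^bsub>H\<^esub> x) ` h ` C (underS r a)"
      unfolding image_image
      using sub[OF wo_rel.under_ofilter[OF wo]] sub[OF wo_rel.underS_ofilter[OF wo]]
      by (intro image_cong refl r_coset_image) (auto dest: subgroup.mem_carrier)
    ultimately show ?thesis
      by (simp add: finite_index_in_def rcosets_restrict_carrier)
  qed
  moreover have "h ` C L = (\<Inter>I\<in>{I. ofilter r I \<and> I \<subset> L}. h ` C I)" if L: "limit_segment r L" for L
  proof -
    have eq: "C L = (\<Inter>I\<in>{I. ofilter r I \<and> I \<subset> L}. C I)"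
      using C L by (simp add: residually_finite_chain_def)
    have "{} \<in> {I. ofilter r I \<and> I \<subset> L}"
      using L by (auto simp: limit_segment_def ofilter_def)
    then show ?thesis
      unfolding eq by (intro image_INT[OF inj]) (use sub in \<open>blast dest: subgroup.subset\<close>)+
  qed
  moreover have "subgroup (h ` C I) H" if "ofilter r I" for I
    using sub[OF that] by (rule subgroup_img_is_subgroup)
  ultimately have "residually_finite_chain r H (\<lambda>I. h ` C I)"
    using C img unfolding residually_finite_chain_def by (auto simp: image_mono)
  then show ?thesis
    by (auto simp: residually_finite_def)
qed

lemma (in group) countable_generate:
  assumes "S \<subseteq> carrier G" "countable S"
  shows "countable (generate G S)"
proof -
  let ?f = "\<lambda>xs. foldr (\<otimes>) xs \<one>"
  let ?L = "lists (S \<union> m_inv G ` S)"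
  have car: "S \<union> m_inv G ` S \<subseteq> carrier G"
    using assms(1) by auto
  have app: "?f (xs @ ys) = ?f xs \<otimes> ?f ys" "?f xs \<in> carrier G" "?f ys \<in> carrier G"
    if "xs \<in> ?L" "ys \<in> ?L" for xs ys
  proof -
    have c: "?f zs \<in> carrier G" if "zs \<in> ?L" for zs
      using that car by (induction zs) auto
    show "?f xs \<in> carrier G" "?f ys \<in> carrier G"
      using c that by auto
    show "?f (xs @ ys) = ?f xs \<otimes> ?f ys"
      using that(1)
    proof induction
      case (Cons x xs)
      then show ?case
        using car c[of xs] c[OF that(2)] by (auto simp: m_assoc subset_iff)
    qed (simp add: c[OF that(2)])
  qed
  have "x \<in> ?f ` ?L" if "x \<in> generate G S" for x
    using that
  proof induction
    case one
    show ?case by (rule image_eqI[where x = "[]"]) auto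
  next
    case (incl h)
    then show ?case using assms(1) by (intro image_eqI[where x = "[h]"]) auto
  next
    case (inv h)
    then show ?case using assms(1) by (intro image_eqI[where x = "[inv h]"]) auto
  next
    case (eng h1 h2)
    then obtain xs ys where "xs \<in> ?L" "ys \<in> ?L" "h1 = ?f xs" "h2 = ?f ys"
      by blast
    then show ?case
      using app by (intro image_eqI[where x = "xs @ ys"]) auto
  qed
  then have "generate G S \<subseteq> ?f ` ?L"
    by blast
  moreover have "countable ?L"
    using assms(2) by (intro countable_lists) auto
  ultimately show ?thesis
    by (meson countable_image countable_subset)
qed

lemma finitely_generated_iso:
  assumes "group G" "group H" "h \<in> iso G H" "finitely_generated G"
  shows "finitely_generated H"
proof -
  interpret group_hom G H h
    using assms by (simp add: group_hom_def group_hom_axioms_def iso_def)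
  obtain S where "finite S" "S \<subseteq> carrier G" "generate G S = carrier G"
    using assms(4) by (auto simp: finitely_generated_def)
  then have "finite (h ` S)" "h ` S \<subseteq> carrier H" "generate H (h ` S) = carrier H"
    using generate_img[of S] assms(3) by (auto simp: iso_def bij_betw_def)
  then show ?thesis
    by (auto simp: finitely_generated_def)
qed

text \<open>The carrier is countable, so the group structure can be moved along an injection into
  \<open>nat\<close>.\<close>

lemma finitely_generated_iso_nat:
  assumes "group G" "finitely_generated G"
  obtains H :: "nat monoid" and h where "group H" "h \<in> iso G H"
proof -
  interpret group G by fact
  have "countable (carrier G)"
    using assms(2) countable_generate countable_finite unfolding finitely_generated_def by metis
  then obtain f :: "_ \<Rightarrow> nat" where f: "inj_on f (carrier G)"
    by (auto simp: countable_def)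
  define H where
    "H = \<lparr>carrier = f ` carrier G,
      mult = \<lambda>x y. f (inv_into (carrier G) f x \<otimes>\<^bsub>G\<^esub> inv_into (carrier G) f y), one = f \<one>\<^bsub>G\<^esub>\<rparr>"
  have "f \<in> iso G H"
    using f by (auto simp: iso_def hom_def bij_betw_def H_def)
  moreover from this have "group (H\<lparr>one := f \<one>\<^bsub>G\<^esub>\<rparr>)"
    by (rule iso_imp_img_group)
  ultimately show thesis
    using that[of H f] by (simp add: H_def)
qed

section \<open>The iterated wreath power\<close>

definition perm_group :: "('a \<Rightarrow> 'a) monoid"
  where "perm_group = \<lparr>carrier = {f. bij f}, mult = (\<circ>), one = id\<rparr>"

lemma perm_group_simps [simp]:
  "carrier perm_group = {f. bij f}" "f \<otimes>\<^bsub>perm_group\<^esub> g = f \<circ> g" "\<one>\<^bsub>perm_group\<^esub> = id"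
  by (simp_all add: perm_group_def)

lemma group_perm_group: "group perm_group"
proof (rule groupI)
  fix f :: "'a \<Rightarrow> 'a" assume "f \<in> carrier perm_group"
  then show "\<exists>g\<in>carrier perm_group. g \<otimes>\<^bsub>perm_group\<^esub> f = \<one>\<^bsub>perm_group\<^esub>"
    by (intro bexI[of _ "inv_into UNIV f"]) (simp_all add: bij_imp_bij_inv bij_is_inj)
qed (auto simp: bij_comp comp_assoc)

section \<open>Words over the integer lattice and elementary matrices\<close>

type_synonym word = "nat \<Rightarrow> 3 \<Rightarrow> int"

text \<open>A unit vector, since linear maps fix 0: the marked vertex must be moved by
  \<open>elementary k 1 0 c\<close> for every nonzero \<open>c\<close>.\<close>

definition base :: "3 \<Rightarrow> int"
  where "base i = (if i = 0 then 1 else 0)"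

definition below_base :: "nat \<Rightarrow> word set"
  where "below_base k = {w. \<forall>l<k. w l = base}"

text \<open>
  The tree is encoded by infinite words over \<open>\<int>\<^sup>3\<close>. The elementary matrix \<open>e\<^sub>i\<^sub>j(c)\<close> acts on the
  children of the vertex \<open>base\<^sup>k\<close>, that is, on letter \<open>k\<close> of the words that begin with \<open>base\<^sup>k\<close>.
\<close>

definition elementary :: "nat \<Rightarrow> 3 \<Rightarrow> 3 \<Rightarrow> int \<Rightarrow> word \<Rightarrow> word"
  where "elementary k i j c w =
    (if w \<in> below_base k then w(k := (w k)(i := w k i + c * w k j)) else w)"

lemma elementary_below_base: "k \<le> l \<Longrightarrow> elementary l i j c w \<in> below_base k \<longleftrightarrow> w \<in> below_base k"
  by (auto simp: elementary_def below_base_def)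

lemma elementary_outside: "k \<le> l \<Longrightarrow> w \<notin> below_base k \<Longrightarrow> elementary l i j c w = w"
  by (auto simp: elementary_def below_base_def)

lemma elementary_zero: "elementary k i j 0 = id"
  by (auto simp: elementary_def fun_eq_iff)

lemma elementary_add: "i \<noteq> j \<Longrightarrow> elementary k i j c \<circ> elementary k i j d = elementary k i j (c + d)"
  by (auto simp: elementary_def below_base_def fun_eq_iff algebra_simps)

lemma bij_elementary: "i \<noteq> j \<Longrightarrow> bij (elementary k i j c)"
  by (rule o_bij[of "elementary k i j (- c)"]) (simp_all add: elementary_add elementary_zero)

text \<open>A Steinberg relation. It makes every generator a commutator and is the reason for size
  3: a third index \<open>p\<close> must exist.\<close>

lemma elementary_commutator:
  assumes "i \<noteq> p" "p \<noteq> j" "i \<noteq> j"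
  shows "elementary k i p c \<circ> elementary k p j 1 \<circ> elementary k i p (- c) \<circ> elementary k p j (- 1) = elementary k i j c"
proof
  fix w
  show "(elementary k i p c \<circ> elementary k p j 1 \<circ> elementary k i p (- c) \<circ> elementary k p j (- 1)) w = elementary k i j c w"
  proof (cases "w \<in> below_base k")
    case True
    have upd: "elementary k i' j' c' (w(k := v)) = w(k := v(i' := v i' + c' * v j'))" for i' j' c' v
      using True by (simp add: elementary_def below_base_def)
    let ?r = "\<lambda>i' j' c' v. v(i' := v i' + c' * v j')"
    have "?r i p c (?r p j 1 (?r i p (- c) (?r p j (- 1) (w k)))) = ?r i j c (w k)"
      using assms by (intro ext) (simp add: algebra_simps)
    \<comment> \<open>Writing \<open>w\<close> as \<open>w(k := w k)\<close> lets \<open>upd\<close>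
      reduce the composition to row operations on one letter.\<close>
    then have "(elementary k i p c \<circ> elementary k p j 1 \<circ> elementary k i p (- c) \<circ> elementary k p j (- 1)) (w(k := w k))
        = elementary k i j c (w(k := w k))"
      unfolding comp_apply upd by (rule arg_cong)
    then show ?thesis
      unfolding fun_upd_triv .
  qed (simp add: elementary_def)
qed

lemma elementary_moves_base:
  assumes "c \<noteq> 0" "w \<in> below_base (Suc k)"
  shows "elementary k 1 0 c w \<notin> below_base (Suc k)"
proof -
  have "w \<in> below_base k" "w k = base"
    using assms(2) by (auto simp: below_base_def)
  then have "elementary k 1 0 c w k 1 = c"
    by (simp add: elementary_def base_def)
  moreover have "base 1 = 0"
    by (simp add: base_def)
  ultimately show ?thesis
    using assms(1) unfolding below_base_def by fastforce
qed

lemma inv_perm_elementary: "i \<noteq> j \<Longrightarrow> inv\<^bsub>perm_group\<^esub> elementary k i j c = elementary k i j (- c)"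
  by (rule group.inv_equality[OF group_perm_group]) (simp_all add: bij_elementary elementary_add elementary_zero)

text \<open>For \<open>m = 0\<close>, where \<open>x mod 0 = x\<close>, this says that the words agree up to and including letter \<open>k\<close>.\<close>

definition letter_cong :: "nat \<Rightarrow> int \<Rightarrow> word \<Rightarrow> word \<Rightarrow> bool"
  where "letter_cong k m v w \<longleftrightarrow> (\<forall>l<k. v l = w l) \<and> (\<forall>i. v k i mod m = w k i mod m)"

lemma letter_cong_sym: "letter_cong k m v w \<Longrightarrow> letter_cong k m w v"
  by (simp add: letter_cong_def)

lemma letter_cong_trans: "letter_cong k m u v \<Longrightarrow> letter_cong k m v w \<Longrightarrow> letter_cong k m u w"
  by (simp add: letter_cong_def)

text \<open>For \<open>l \<le> k\<close>, whether the matrix acts is decided by letters before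
  \<open>k\<close>, on which the words agree, and integer matrices respect congruences. For
  \<open>l > k\<close>, letters up to \<open>k\<close> stay unchanged.\<close>

lemma letter_cong_elementary:
  assumes "letter_cong k m v w"
  shows "letter_cong k m (elementary l i j c v) (elementary l i j c w)"
proof -
  have eq: "v l' = w l'" if "l' < k" for l'
    using assms that by (simp add: letter_cong_def)
  have cong: "v k i mod m = w k i mod m" for i
    using assms by (simp add: letter_cong_def)
  show ?thesis
  proof (cases "l \<le> k")
    case True
    have "v \<in> below_base l \<longleftrightarrow> w \<in> below_base l"
      using True eq by (auto simp: below_base_def)
    moreover have "(v k i + c * v k j) mod m = (w k i + c * w k j) mod m"
      by (intro mod_add_cong mod_mult_cong cong refl)
    ultimately show ?thesis
      using eq cong by (auto simp: letter_cong_def elementary_def)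
  next
    case False
    then show ?thesis
      using eq cong by (auto simp: letter_cong_def elementary_def)
  qed
qed

section \<open>Generators, layers and finite generation\<close>

definition elems :: "nat \<Rightarrow> nat \<Rightarrow> (word \<Rightarrow> word) set"
  where "elems n k = {elementary l i j c | l i j c. k \<le> l \<and> l < n \<and> i \<noteq> j}"

text \<open>The subgroup \<open>T\<^sub>k\<close>, acting below the vertex \<open>base\<^sup>k\<close>.\<close>

definition layer :: "nat \<Rightarrow> nat \<Rightarrow> (word \<Rightarrow> word) set"
  where "layer n k = generate perm_group (elems n k)"

definition tree_group :: "nat \<Rightarrow> (word \<Rightarrow> word) monoid"
  where "tree_group n = perm_group\<lparr>carrier := layer n 0\<rparr>"

lemma tree_group_simps [simp]:
  "carrier (tree_group n) = layer n 0" "f \<otimes>\<^bsub>tree_group n\<^esub> g = f \<circ> g" "\<one>\<^bsub>tree_group n\<^esub> = id"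
  by (simp_all add: tree_group_def)

lemma elems_bij: "elems n k \<subseteq> carrier perm_group"
  by (auto simp: elems_def bij_elementary)

lemma subgroup_layer_perm_group: "subgroup (layer n k) perm_group"
  unfolding layer_def by (rule group.generate_is_subgroup[OF group_perm_group elems_bij])

lemma group_tree_group: "group (tree_group n)"
  unfolding tree_group_def
  by (rule subgroup.subgroup_is_group[OF subgroup_layer_perm_group group_perm_group])

lemma layer_mono: "k \<le> k' \<Longrightarrow> layer n k' \<subseteq> layer n k"
  unfolding layer_def by (rule group.mono_generate[OF group_perm_group]) (fastforce simp: elems_def)

lemma subgroup_layer: "subgroup (layer n k) (tree_group n)"
  unfolding tree_group_def
  by (rule group.subgroup_incl[OF group_perm_group subgroup_layer_perm_group subgroup_layer_perm_group layer_mono])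
    simp

lemma elementary_in_layer: "k \<le> l \<Longrightarrow> l < n \<Longrightarrow> i \<noteq> j \<Longrightarrow> elementary l i j c \<in> layer n k"
  unfolding layer_def by (rule generate.incl) (auto simp: elems_def)

lemma inv_tree_elementary:
  assumes "l < n" "i \<noteq> j"
  shows "inv\<^bsub>tree_group n\<^esub> elementary l i j c = elementary l i j (- c)"
  using assms
  by (intro group.inv_equality[OF group_tree_group]) (simp_all add: elementary_in_layer elementary_add elementary_zero)

text \<open>There is no case for inverses: negating \<open>c\<close> turns a generator into its
  inverse.\<close>

lemma layer_induct [consumes 1, case_names id elem comp]:
  assumes "f \<in> layer n k" "P id"
    and "\<And>l i j c. k \<le> l \<Longrightarrow> l < n \<Longrightarrow> i \<noteq> j \<Longrightarrow> P (elementary l i j c)"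
    and "\<And>f g. P f \<Longrightarrow> P g \<Longrightarrow> P (f \<circ> g)"
  shows "P f"
  using assms(1) unfolding layer_def
proof (induction rule: generate.induct)
  case one
  then show ?case using assms(2) by (simp only: perm_group_simps)
next
  case (incl h)
  then show ?case using assms(3) by (auto simp: elems_def)
next
  case (inv h)
  then show ?case using assms(3) by (auto simp: elems_def inv_perm_elementary)
next
  case (eng h1 h2)
  then show ?case using assms(4) by (simp only: perm_group_simps)
qed

lemma letter_cong_layer:
  assumes "f \<in> layer n k"
  shows "letter_cong l m v w \<Longrightarrow> letter_cong l m (f v) (f w)"
  using assms by (induction arbitrary: v w rule: layer_induct) (auto simp: letter_cong_elementary)

lemma layer_fixes_letter:
  assumes "f \<in> layer n k" "n \<le> l"
  shows "f w l = w l"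
  using assms by (induction arbitrary: w rule: layer_induct) (auto simp: elementary_def)

text \<open>The matrices with \<open>c = 1\<close> suffice, as their powers and inverses give every
  \<open>c\<close>.\<close>

lemma finitely_generated_tree_group: "finitely_generated (tree_group n)"
proof -
  let ?S = "(\<lambda>(l, i, j). elementary l i j 1) ` ({..<n} \<times> {(i, j). i \<noteq> j})"
  interpret group "tree_group n"
    by (rule group_tree_group)
  have S: "?S \<subseteq> layer n 0"
    by (auto intro: elementary_in_layer)
  then interpret gen: subgroup "generate (tree_group n) ?S" "tree_group n"
    by (intro generate_is_subgroup) simp
  have elementary_mem: "elementary l i j c \<in> generate (tree_group n) ?S" if "l < n" "i \<noteq> j" for l i j c
  proof -
    have nat: "elementary l i j (int t) \<in> generate (tree_group n) ?S" for t
    proof (induction t)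
      case 0
      then show ?case
        using gen.one_closed unfolding of_nat_0 elementary_zero tree_group_simps .
    next
      case (Suc t)
      have "elementary l i j 1 \<in> generate (tree_group n) ?S"
        using that by (intro generate.incl image_eqI[where x = "(l, i, j)"]) auto
      from gen.m_closed[OF this Suc] show ?case
        using that by (simp add: elementary_add)
    qed
    show ?thesis
    proof (cases c rule: int_cases2)
      case (nonneg t)
      then show ?thesis using nat by simp
    next
      case (nonpos t)
      then show ?thesis
        using gen.m_inv_closed[OF nat[of t]] that by (simp add: inv_tree_elementary)
    qed
  qed
  have "layer n 0 \<subseteq> generate (tree_group n) ?S"
  proof
    fix f assume "f \<in> layer n 0"
    then show "f \<in> generate (tree_group n) ?S"
    proof (induction rule: layer_induct)
      case id
      then show ?case using gen.one_closed by (simp only: tree_group_simps)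
    next
      case (elem l i j c)
      then show ?case using elementary_mem by simp
    next
      case (comp f g)
      then show ?case using gen.m_closed[of f g] by (simp only: tree_group_simps)
    qed
  qed
  moreover have "generate (tree_group n) ?S \<subseteq> layer n 0"
    using gen.subset by simp
  moreover have "finite ?S"
    by simp
  ultimately show ?thesis
    unfolding finitely_generated_def using S by (intro exI[of _ ?S]) auto
qed

section \<open>Layers that survive \<open>\<omega>\<close> steps\<close>

text \<open>The conjugate fixes \<open>U\<close> pointwise, because \<open>c'\<close> moves
  \<open>U\<close> off itself, and it preserves the complement of \<open>U\<close>, where
  \<open>g\<close> is the identity.\<close>

lemma commute_of_disjoint_supports:
  assumes g: "\<And>w. w \<notin> U \<Longrightarrow> g w = w" "\<And>w. w \<in> U \<Longrightarrow> g w \<in> U"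
    and h: "\<And>w. w \<notin> U \<Longrightarrow> h w = w" "\<And>w. w \<in> U \<Longrightarrow> h w \<in> U"
    and c: "\<And>w. c (c' w) = w" "\<And>w. w \<in> U \<Longrightarrow> c w \<notin> U" "\<And>w. w \<in> U \<Longrightarrow> c' w \<notin> U"
  shows "(c \<circ> h \<circ> c') \<circ> g = g \<circ> (c \<circ> h \<circ> c')"
proof
  fix w
  show "((c \<circ> h \<circ> c') \<circ> g) w = (g \<circ> (c \<circ> h \<circ> c')) w"
    by (cases "w \<in> U"; cases "c' w \<in> U") (simp_all add: assms)
qed

lemma Suc_layer_subset_finite_index:
  assumes "subgroup K (tree_group n)" "finite ((\<lambda>d. K #>\<^bsub>tree_group n\<^esub> d) ` layer n k)"
  shows "layer n (Suc k) \<subseteq> K"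
proof -
  interpret group "tree_group n"
    by (rule group_tree_group)
  interpret K: subgroup K "tree_group n" by fact
  have elementary_mem: "elementary l i j c \<in> K" if l: "Suc k \<le> l" "l < n" "i \<noteq> j" for l i j c
  proof -
    have "card {i, j} \<noteq> CARD(3)"
      using l(3) by simp
    then have "{i, j} \<noteq> UNIV" by metis
    then obtain p where p: "p \<noteq> i" "p \<noteq> j" by auto
    \<comment> \<open>Which power of \<open>?a\<close> will be used is unknown, so every positive
      power must move \<open>base\<close> at level \<open>k\<close>. \<open>?h\<close> and
      \<open>?g\<close> are chosen to have commutator \<open>elementary l i j c\<close>.\<close>
    let ?a = "elementary k 1 0 1" and ?h = "elementary l i p c" and ?g = "elementary l p j 1"
    have pow: "?a [^]\<^bsub>tree_group n\<^esub> m = elementary k 1 0 (int m)" for m :: nat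
      by (induction m) (simp_all add: elementary_zero elementary_add add.commute)
    have "?h \<otimes>\<^bsub>tree_group n\<^esub> ?g \<otimes>\<^bsub>tree_group n\<^esub> inv\<^bsub>tree_group n\<^esub> ?h \<otimes>\<^bsub>tree_group n\<^esub> inv\<^bsub>tree_group n\<^esub> ?g \<in> K"
    proof (rule commutator_in_finite_index[OF subgroup_layer assms])
      show "?a \<in> layer n k" "?h \<in> layer n k" "?g \<in> layer n k"
        using l p by (auto intro!: elementary_in_layer)
      fix m :: nat assume "m > 0"
      have "elementary k 1 0 (int m) \<circ> ?h \<circ> elementary k 1 0 (- int m) \<circ> ?g
          = ?g \<circ> (elementary k 1 0 (int m) \<circ> ?h \<circ> elementary k 1 0 (- int m))"
      proof (rule commute_of_disjoint_supports[where U = "below_base (Suc k)"])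
        show "elementary k 1 0 (int m) (elementary k 1 0 (- int m) w) = w" for w
          using elementary_add[of 1 0 k "int m" "- int m"] by (simp add: elementary_zero fun_eq_iff)
      qed (use l \<open>m > 0\<close> in \<open>simp_all add: elementary_outside elementary_below_base elementary_moves_base\<close>)
      then show "?a [^]\<^bsub>tree_group n\<^esub> m \<otimes>\<^bsub>tree_group n\<^esub> ?h \<otimes>\<^bsub>tree_group n\<^esub> inv\<^bsub>tree_group n\<^esub> (?a [^]\<^bsub>tree_group n\<^esub> m) \<otimes>\<^bsub>tree_group n\<^esub> ?g
          = ?g \<otimes>\<^bsub>tree_group n\<^esub> (?a [^]\<^bsub>tree_group n\<^esub> m \<otimes>\<^bsub>tree_group n\<^esub> ?h \<otimes>\<^bsub>tree_group n\<^esub> inv\<^bsub>tree_group n\<^esub> (?a [^]\<^bsub>tree_group n\<^esub> m))"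
        using l by (simp add: pow inv_tree_elementary)
    qed
    then show ?thesis
      using l p by (simp add: inv_tree_elementary elementary_commutator)
  qed
  show ?thesis
  proof
    fix f assume "f \<in> layer n (Suc k)"
    then show "f \<in> K"
    proof (induction rule: layer_induct)
      case id
      then show ?case using K.one_closed by (simp only: tree_group_simps)
    next
      case (elem l i j c)
      then show ?case using elementary_mem by simp
    next
      case (comp f g)
      then show ?case using K.m_closed[of f g] by (simp only: tree_group_simps)
    qed
  qed
qed

lemma tree_group_not_residually_finite:
  assumes "k < n"
  shows "\<not> residually_finite (omega_times k) (tree_group n)"
proof
  assume "residually_finite (omega_times k) (tree_group n)"
  then have "layer n k \<subseteq> {id}"
    using group.not_residually_finite_omega_times[OF group_tree_group, of "layer n" n k]
      Suc_layer_subset_finite_index layer_mono[of _ "Suc _" n] by (simp add: layer_mono)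
  then have "elementary k 1 0 1 = id"
    using elementary_in_layer[of k k n 1 0 1] assms by auto
  moreover have "(\<lambda>_. base) \<in> below_base (Suc k)"
    by (simp add: below_base_def)
  ultimately show False
    using elementary_moves_base[of 1 "\<lambda>_. base" k] by simp
qed

section \<open>Congruence stabilizers and the chain of length
  \<open>\<omega> \<cdot> n\<close>\<close>

text \<open>Vertices are coded by lists, which form a countable type, and padded with zero
  letters.\<close>

definition finite_word :: "(3 \<Rightarrow> int) list \<Rightarrow> word"
  where "finite_word xs l = (if l < length xs then xs ! l else (\<lambda>_. 0))"

text \<open>The first index component codes a modulus and a vertex, so that one block of
  \<open>\<omega>\<close> runs through all of them. \<open>Suc m\<close> avoids modulus 0, which
  would demand equality.\<close>

definition cong_stabilizer :: "nat \<Rightarrow> nat \<times> nat \<Rightarrow> (word \<Rightarrow> word) set"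
  where "cong_stabilizer n = (\<lambda>(t, k). case from_nat t of (m :: nat, xs) \<Rightarrow>
    {f \<in> layer n 0. letter_cong k (int (Suc m)) (f (finite_word xs)) (finite_word xs)})"

lemma subgroup_cong_stabilizer: "subgroup (cong_stabilizer n (t, k)) (tree_group n)"
proof -
  interpret group "tree_group n"
    by (rule group_tree_group)
  interpret L: subgroup "layer n 0" "tree_group n"
    by (rule subgroup_layer)
  obtain m xs where t: "from_nat t = (m :: nat, xs :: (3 \<Rightarrow> int) list)"
    by force
  let ?w = "finite_word xs" and ?c = "letter_cong k (int (Suc m))"
  have S: "cong_stabilizer n (t, k) = {f \<in> layer n 0. ?c (f ?w) ?w}"
    by (simp add: cong_stabilizer_def t)
  show ?thesis
    unfolding S
  proof (rule subgroupI)
    have "id \<in> {f \<in> layer n 0. ?c (f ?w) ?w}"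
      using L.one_closed by (simp add: letter_cong_def)
    then show "{f \<in> layer n 0. ?c (f ?w) ?w} \<noteq> {}" by blast
  next
    fix f assume f: "f \<in> {f \<in> layer n 0. ?c (f ?w) ?w}"
    then have inv: "inv\<^bsub>tree_group n\<^esub> f \<in> layer n 0"
      using L.m_inv_closed by simp
    have "inv\<^bsub>tree_group n\<^esub> f \<circ> f = id"
      using l_inv[of f] f by simp
    then have "(inv\<^bsub>tree_group n\<^esub> f) (f ?w) = ?w"
      by (simp add: fun_eq_iff)
    then have "?c ((inv\<^bsub>tree_group n\<^esub> f) ?w) ?w"
      using letter_cong_layer[OF inv, of k "int (Suc m)" "f ?w" ?w] f
      by (auto intro: letter_cong_sym)
    then show "inv\<^bsub>tree_group n\<^esub> f \<in> {f \<in> layer n 0. ?c (f ?w) ?w}"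
      using inv by simp
  next
    fix f g assume "f \<in> {f \<in> layer n 0. ?c (f ?w) ?w}" "g \<in> {f \<in> layer n 0. ?c (f ?w) ?w}"
    then show "f \<otimes>\<^bsub>tree_group n\<^esub> g \<in> {f \<in> layer n 0. ?c (f ?w) ?w}"
      using L.m_closed[of f g] letter_cong_layer[of f n 0 k "int (Suc m)" "g ?w" ?w]
      by (auto intro: letter_cong_trans)
  qed auto
qed

lemma cong_stabilizers_fix_letter:
  assumes "f \<in> layer n 0" and stab: "\<And>t. f \<in> cong_stabilizer n (t, l)"
  shows "f w l = w l"
proof
  fix i
  \<comment> \<open>Letter \<open>l\<close> of \<open>f w\<close> depends only on the letters of
    \<open>w\<close> up to \<open>l\<close>, by \<open>letter_cong\<close> with modulus 0.\<close>
  let ?xs = "map w [0..<Suc l]"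
  let ?v = "finite_word ?xs"
  have vw: "?v l' = w l'" if "l' \<le> l" for l'
    using that by (simp add: finite_word_def del: upt_Suc)
  then have "letter_cong l 0 (f ?v) (f w)"
    by (intro letter_cong_layer[OF assms(1)]) (simp add: letter_cong_def)
  then have "f w l i = f ?v l i"
    by (simp add: letter_cong_def)
  \<comment> \<open>The modulus \<open>Suc m\<close> exceeds the distance of the two entries, so
    congruence forces equality.\<close>
  define m where "m = nat \<bar>f ?v l i - w l i\<bar>"
  have "f \<in> cong_stabilizer n (to_nat (m, ?xs), l)"
    by (rule stab)
  then have "f ?v l i mod int (Suc m) = w l i mod int (Suc m)"
    using vw by (simp add: cong_stabilizer_def letter_cong_def del: upt_Suc)
  then have "int (Suc m) dvd f ?v l i - w l i"
    by (simp add: mod_eq_dvd_iff)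
  moreover have "\<bar>f ?v l i - w l i\<bar> < int (Suc m)"
    by (simp add: m_def)
  ultimately have "f ?v l i - w l i = 0"
    using zdvd_imp_le[of "int (Suc m)" "\<bar>f ?v l i - w l i\<bar>"] by fastforce
  then show "f w l i = w l i"
    using \<open>f w l i = f ?v l i\<close> by simp
qed

lemma tree_group_residually_finite: "residually_finite (omega_times n) (tree_group n)"
proof (rule group.residually_finiteI[OF group_tree_group Well_order_omega_times, where F = "cong_stabilizer n"])
  interpret group "tree_group n"
    by (rule group_tree_group)
  show "subgroup (cong_stabilizer n p) (tree_group n)" for p
    by (cases p) (simp add: subgroup_cong_stabilizer)
  have "f = id" if "f \<in> layer n 0" "\<And>p. p \<in> Field (omega_times n) \<Longrightarrow> f \<in> cong_stabilizer n p" for f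
  proof (rule ext, rule ext)
    fix w l
    show "f w l = id w l"
    proof (cases "l < n")
      case True
      then show ?thesis
        using cong_stabilizers_fix_letter[of f n l w] that by (simp add: Field_omega_times)
    qed (use layer_fixes_letter that in auto)
  qed
  moreover have "id \<in> cong_stabilizer n p" for p
    using subgroup.one_closed[OF subgroup_cong_stabilizer] by (cases p) auto
  moreover have "id \<in> layer n 0"
    using subgroup.one_closed[OF subgroup_layer[of n 0]] by simp
  ultimately show "carrier (tree_group n) \<inter> (\<Inter>p\<in>Field (omega_times n). cong_stabilizer n p)
      = {\<one>\<^bsub>tree_group n\<^esub>}"
    by auto
  fix p assume "p \<in> Field (omega_times n)"
  then obtain t k where p: "p = (t, k)" "k < n"
    by (auto simp: Field_omega_times)
  obtain m xs where t: "from_nat t = (m :: nat, xs :: (3 \<Rightarrow> int) list)"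
    by force
  let ?w = "finite_word xs" and ?m = "int (Suc m)"
  let ?H = "carrier (tree_group n) \<inter> (\<Inter>q\<in>underS (omega_times n) p. cong_stabilizer n q)"
  have under: "under (omega_times n) p = insert p (underS (omega_times n) p)"
    using p by (auto simp: under_def underS_def omega_times_iff)
  have stab: "subgroup (cong_stabilizer n q) (tree_group n)" for q
    by (cases q) (simp add: subgroup_cong_stabilizer)
  then interpret H: subgroup ?H "tree_group n"
    by (rule subgroup_carrier_INT)
  \<comment> \<open>All blocks before \<open>k\<close> are complete at this index, so only letter
    \<open>k\<close> needs control.\<close>
  have fixed: "h w l = w l" if "h \<in> ?H" "l < k" for h w l
    using that p
    by (intro cong_stabilizers_fix_letter[of h n l w]) (auto simp: underS_def omega_times_iff)
  \<comment> \<open>Inverses match the right cosets: if the inverses of \<open>g\<close> and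
    \<open>h\<close> send \<open>?w\<close> to congruent words, then \<open>g\<close> times the
    inverse of \<open>h\<close> sends \<open>?w\<close> to a word congruent to it.\<close>
  let ?f = "\<lambda>h i. (inv\<^bsub>tree_group n\<^esub> h) ?w k i mod ?m"
  show "finite_index_in (tree_group n) ?H
      (carrier (tree_group n) \<inter> (\<Inter>q\<in>under (omega_times n) p. cong_stabilizer n q))"
  proof (rule finite_index_inI[where f = ?f])
    show "subgroup (carrier (tree_group n) \<inter> (\<Inter>q\<in>under (omega_times n) p. cong_stabilizer n q)) (tree_group n)"
      using stab by (rule subgroup_carrier_INT)
    show "?H \<subseteq> carrier (tree_group n)"
      by blast
    have "?f ` ?H \<subseteq> (UNIV \<rightarrow>\<^sub>E {0..<?m})"
      by auto
    then show "finite (?f ` ?H)"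
      by (rule finite_subset) (simp add: finite_PiE)
    fix g h assume gh: "g \<in> ?H" "h \<in> ?H" "?f g = ?f h"
    let ?g' = "inv\<^bsub>tree_group n\<^esub> g" and ?h' = "inv\<^bsub>tree_group n\<^esub> h"
    have inv: "?g' \<in> ?H" "?h' \<in> ?H"
      using gh by (simp_all only: H.m_inv_closed)
    have "letter_cong k ?m (?h' ?w) (?g' ?w)"
      using fixed[OF inv(1)] fixed[OF inv(2)] gh(3) unfolding letter_cong_def by metis
    moreover have g: "g \<in> layer n 0"
      using gh(1) by simp
    ultimately have "letter_cong k ?m (g (?h' ?w)) (g (?g' ?w))"
      by (rule letter_cong_layer[rotated])
    moreover have "g \<circ> ?g' = id"
      using r_inv[of g] g by simp
    then have "g (?g' ?w) = ?w"
      by (metis comp_apply id_apply)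
    moreover have gh': "g \<circ> ?h' \<in> ?H"
      using H.m_closed[OF gh(1) inv(2)] unfolding tree_group_simps .
    ultimately have "g \<circ> ?h' \<in> cong_stabilizer n p"
      using p by (simp add: cong_stabilizer_def t)
    then show "g \<otimes>\<^bsub>tree_group n\<^esub> ?h'
        \<in> carrier (tree_group n) \<inter> (\<Inter>q\<in>under (omega_times n) p. cong_stabilizer n q)"
      using gh' unfolding under tree_group_simps by blast
  qed
qed

theorem theorem1p1:
  fixes n :: nat
  assumes "n \<ge> 1"
  shows "\<exists>G :: nat monoid. group G \<and> finitely_generated G \<and>
    residually_finite (omega_times n) G \<and> \<not> residually_finite (omega_times (n - 1)) G"
proof -
  obtain G :: "nat monoid" and h where G: "group G" "h \<in> iso (tree_group n) G"
    using finitely_generated_iso_nat[OF group_tree_group finitely_generated_tree_group] .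
  \<comment> \<open>The negative half needs the inverse isomorphism: a chain in \<open>G\<close>
    would give one in the tree group.\<close>
  moreover have "inv_into (carrier (tree_group n)) h \<in> iso G (tree_group n)"
    using group.iso_set_sym[OF group_tree_group G(2)] .
  ultimately show ?thesis
    using finitely_generated_iso[OF group_tree_group G finitely_generated_tree_group]
      residually_finite_iso[OF group_tree_group G tree_group_residually_finite Well_order_omega_times]
      residually_finite_iso[OF G(1) group_tree_group _ _ Well_order_omega_times]
      tree_group_not_residually_finite[of "n - 1" n] assms
    by (metis One_nat_def Suc_le_lessD diff_less zero_less_one)
qed

end
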